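(* Suppose there exist (1) a random vector $\vartheta(\omega)$, with $\vartheta^{\top}(\omega)=(\widetilde q(\omega)^{\top},\widetilde h(\omega),\widetilde T(\omega),\widetilde W(\omega))$, having a known probability distribution that does not depend on the first-stage decision $x\in\mathcal X$, and (2) a transformation function $t(x,\boldsymbol\vartheta)=\big(t_1(x,\widetilde q(\omega)^{\top}),\,t_2(x,\widetilde h(\omega)),\,t_3(x,\widetilde T(\omega)),\,t_4(x,\widetilde W(\omega))\big)$ such that $\boldsymbol\xi_x=t(x,\boldsymbol\vartheta)$ for $x\in\mathcal X$, i.e. $t_1,t_2,t_3,t_4$ return respectively $q_x(\omega)^{\top},h_x(\omega),T_x(\omega),W_x(\omega)$. Then $$g(x)=\mathbb E_{\boldsymbol\xi\mid x}\big[Q(x,\xi(\omega))\big]=\mathbb E_{\boldsymbol\vartheta}\big[Q_T(x,\vartheta(\omega))\big]$$ for every feasible first-stage decision $x$, and the program with endogenous uncertainty $$\min\{c^{\top}x+\mathbb E_{\boldsymbol\xi\mid x}[Q(x,\xi(\omega))]:\ Ax\ge b,\ x\in\mathcal X\}$$ can be reformulated as the transformed program $$\min\{c^{\top}x+\mathbb E_{\boldsymbol\vartheta}[Q_T(x,\vartheta(\omega))]:\ Ax\ge b,\ x\in\mathcal X\};$$ that is, the two programs have the same optimal solutions.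
   Context: Two-stage stochastic mixed-integer linear program with decision-dependent probability. $\mathcal X\subseteq\mathbb R^{n_1}_+$ and $\mathcal Y\subseteq\mathbb R^{n_2}_+$ are compact sets (imposing non-negativity and continuous, integer or binary restrictions); $A,b,c$ are deterministic data of appropriate dimensions; $x$ is the first-stage decision. The second-stage data form a random vector $\boldsymbol\xi=\xi(\omega)$ with $\xi^{\top}(\omega)=(q(\omega)^{\top},h(\omega)^{\top},T(\omega),W(\omega))$, whose probability distribution depends on $x$. $\mathbb E_{\boldsymbol\xi\mid x}$ is expectation with respect to the conditional distribution of $\boldsymbol\xi$ given $x$. For $x\in\mathcal X$, $\boldsymbol\xi_x$, with $\boldsymbol\xi_x^{\top}=(q_x(\omega)^{\top},h_x(\omega)^{\top},T_x(\omega),W_x(\omega))$, denotes a random vector following the conditional distribution of $\boldsymbol\xi$ given $x$. The second-stage value function is $$Q(x,\xi(\omega))=\min\{q(\omega)^{\top}y:\ T(\omega)x+W(\omega)y\ge h(\omega),\ y\in\mathcal Y\},$$ and $g(x)=\mathbb E_{\boldsymbol\xi\mid x}[Q(x,\xi(\omega))]$. The transformed second-stage value function is $$Q_T(x,\vartheta(\omega))=\min\{t_1(x,\widetilde q(\omega)^{\top})\,y:\ t_3(x,\widetilde T(\omega))x+t_4(x,\widetilde W(\omega))y\ge t_2(x,\widetilde h(\omega)),\ y\in\mathcal Y\}.$$ $\mathbb E_{\boldsymbol\vartheta}$ is expectation with respect to the (decision-independent) distribution of $\boldsymbol\vartheta=\vartheta(\omega)$, which need not have the same dimension as $\boldsymbol\xi$.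 The functions involved are measurable and the expectations are well defined. *)

theory Defs
  imports "HOL-Probability.Probability"
begin

text \<open>
  Value functions are extended real: the minimum over an empty feasible set is \<open>\<infinity>\<close>, as usual
  when no relatively complete recourse is assumed. Vectors carry the componentwise order.
\<close>

type_synonym ('n1, 'n2, 'm2) stage2_data =
  "(real^'n2) \<times> (real^'m2) \<times> (real^'n1^'m2) \<times> (real^'n2^'m2)"

definition second_stage_value ::
  "(real^'n2) set \<Rightarrow> real^'n1 \<Rightarrow> ('n1::finite, 'n2::finite, 'm2::finite) stage2_data \<Rightarrow> ereal"
where
  "second_stage_value Y x \<xi> =
     (case \<xi> of (q, h, T, W) \<Rightarrow>
        INF y\<in>{y \<in> Y. T *v x + W *v y \<ge> h}. ereal (q \<bullet> y))"

definition transformed_value ::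
  "(real^'n2) set \<Rightarrow>
   (real^'n1 \<Rightarrow> 'qt \<Rightarrow> real^'n2) \<Rightarrow> (real^'n1 \<Rightarrow> 'ht \<Rightarrow> real^'m2) \<Rightarrow>
   (real^'n1 \<Rightarrow> 'tt \<Rightarrow> real^'n1^'m2) \<Rightarrow> (real^'n1 \<Rightarrow> 'wt \<Rightarrow> real^'n2^'m2) \<Rightarrow>
   real^'n1 \<Rightarrow> 'qt \<times> 'ht \<times> 'tt \<times> 'wt \<Rightarrow> ereal"
where
  "transformed_value Y t1 t2 t3 t4 x \<theta> =
     (case \<theta> of (q, h, T, W) \<Rightarrow>
        INF y\<in>{y \<in> Y. t3 x T *v x + t4 x W *v y \<ge> t2 x h}. ereal (t1 x q \<bullet> y))"

definition transformation ::
  "(real^'n1 \<Rightarrow> 'qt \<Rightarrow> real^'n2) \<Rightarrow> (real^'n1 \<Rightarrow> 'ht \<Rightarrow> real^'m2) \<Rightarrow>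
   (real^'n1 \<Rightarrow> 'tt \<Rightarrow> real^'n1^'m2) \<Rightarrow> (real^'n1 \<Rightarrow> 'wt \<Rightarrow> real^'n2^'m2) \<Rightarrow>
   real^'n1 \<Rightarrow> 'qt \<times> 'ht \<times> 'tt \<times> 'wt \<Rightarrow>
   ('n1::finite, 'n2::finite, 'm2::finite) stage2_data"
where
  "transformation t1 t2 t3 t4 x \<theta> =
     (case \<theta> of (q, h, T, W) \<Rightarrow> (t1 x q, t2 x h, t3 x T, t4 x W))"

text \<open>
  Expectation of an extended-real random variable as the difference of the expectations of its
  positive and negative parts (\<^const>\<open>e2ennreal\<close> sends negative values to 0). It is meaningful
  only if these are not both infinite.
\<close>

definition ext_expectation :: "'w measure \<Rightarrow> ('w \<Rightarrow> ereal) \<Rightarrow> ereal" where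
  "ext_expectation M f =
     enn2ereal (\<integral>\<^sup>+\<omega>. e2ennreal (f \<omega>) \<partial>M) - enn2ereal (\<integral>\<^sup>+\<omega>. e2ennreal (- f \<omega>) \<partial>M)"

definition ext_expectation_defined :: "'w measure \<Rightarrow> ('w \<Rightarrow> ereal) \<Rightarrow> bool" where
  "ext_expectation_defined M f \<longleftrightarrow>
     f \<in> borel_measurable M \<and>
     \<not> ((\<integral>\<^sup>+\<omega>. e2ennreal (f \<omega>) \<partial>M) = \<infinity> \<and> (\<integral>\<^sup>+\<omega>. e2ennreal (- f \<omega>) \<partial>M) = \<infinity>)"

text \<open>
  Points of objective value \<open>\<infinity>\<close> count as infeasible, so a program whose objective is \<open>\<infinity>\<close> throughout
  has no optimal solution.
\<close>

definition optimal_solutions :: "('a \<Rightarrow> ereal) \<Rightarrow> 'a set \<Rightarrow> 'a set" where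
  "optimal_solutions f F = {x. is_arg_min f (\<lambda>x. x \<in> F) x \<and> f x < \<infinity>}"

text \<open>
  Over a compact \<open>Y\<close> the infimum in the value function is a minimum whenever the second stage is
  feasible, and the extended expectation is the Bochner one for integrable functions.
\<close>

lemma second_stage_value_attained:
  fixes Y :: "(real^'n2) set" and x :: "real^'n1"
    and h :: "real^'m2" and T :: "real^'n1^'m2" and W :: "real^'n2^'m2"
  assumes "compact Y" and "{y \<in> Y. T *v x + W *v y \<ge> h} \<noteq> {}"
  shows "\<exists>y\<in>{y \<in> Y. T *v x + W *v y \<ge> h}.
           second_stage_value Y x (q, h, T, W) = ereal (q \<bullet> y) \<and>
           (\<forall>z\<in>{y \<in> Y. T *v x + W *v y \<ge> h}. q \<bullet> y \<le> q \<bullet> z)"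
proof -
  let ?F = "{y \<in> Y. T *v x + W *v y \<ge> h}"
  have eq: "?F = Y \<inter> (\<Inter>i. {y. h $ i \<le> (T *v x + W *v y) $ i})"
    by (auto simp: less_eq_vec_def)
  have "closed {y. h $ i \<le> (T *v x + W *v y) $ i}" for i
    by (intro closed_Collect_le continuous_intros matrix_vector_mult_linear_continuous_on)
  then have "compact ?F"
    unfolding eq using assms(1) by (intro compact_Int_closed closed_INT) auto
  then have "\<exists>y\<in>?F. \<forall>z\<in>?F. q \<bullet> y \<le> q \<bullet> z"
    by (rule continuous_attains_inf[OF _ assms(2)]) (intro continuous_intros)
  then obtain y where y: "y \<in> ?F" "\<forall>z\<in>?F. q \<bullet> y \<le> q \<bullet> z"
    by (rule bexE)
  have "second_stage_value Y x (q, h, T, W) = ereal (q \<bullet> y)"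
    unfolding second_stage_value_def prod.case
    by (rule antisym, rule INF_lower[OF y(1)], rule INF_greatest) (use y(2) in auto)
  with y show ?thesis by blast
qed

lemma ext_expectation_eq_lebesgue_integral:
  assumes "integrable M f"
  shows "ext_expectation M (\<lambda>\<omega>. ereal (f \<omega>)) = ereal (\<integral>\<omega>. f \<omega> \<partial>M)"
proof -
  have fin: "(\<integral>\<^sup>+\<omega>. ennreal (f \<omega>) \<partial>M) \<noteq> \<infinity>" "(\<integral>\<^sup>+\<omega>. ennreal (- f \<omega>) \<partial>M) \<noteq> \<infinity>"
    using assms by (auto simp: real_integrable_def)
  have e: "enn2ereal a = ereal (enn2real a)" if "a \<noteq> \<infinity>" for a :: ennreal
    using that by (cases a) (auto simp: enn2ereal_ennreal)
  show ?thesis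
    unfolding ext_expectation_def real_lebesgue_integral_def[OF assms]
    using e[OF fin(1)] e[OF fin(2)] by (simp add: e2ennreal_ereal)
qed

end

theory Submission
  imports Defs
begin

text \<open>
  At a realization \<open>\<theta>\<close>, the transformed second-stage problem is the original one for the data
  \<open>t(x, \<theta>)\<close>, so the transformed value function is the original one composed with the
  transformation. The equality of the expectations then expresses that an expectation depends only
  on the law of the random vector: \<open>\<xi>\<close> under \<open>P x\<close> and \<open>\<xi>\<^sub>x x\<close> under \<open>M\<close> have the same law
  (\<open>ext_expectation_eq_if_distr_eq\<close>), and \<open>\<xi>\<^sub>x x\<close> may be replaced by the almost surely equal
  transform of \<open>\<theta>\<close> (\<open>ext_expectation_cong_AE\<close>).

  This holds at each \<open>x\<close> in \<open>X\<close>, so the objectives of the two programs agree on their common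
  feasible set, and the optimal solutions depend only on the values there.
\<close>

lemma transformed_value_eq_second_stage_value:
  "transformed_value Y t1 t2 t3 t4 x \<theta> = second_stage_value Y x (transformation t1 t2 t3 t4 x \<theta>)"
  by (simp add: transformed_value_def second_stage_value_def transformation_def split: prod.split)

lemma ext_expectation_distr:
  assumes "Z \<in> measurable M N" and "f \<in> borel_measurable N"
  shows "ext_expectation (distr M N Z) f = ext_expectation M (\<lambda>\<omega>. f (Z \<omega>))"
  using assms by (simp add: ext_expectation_def nn_integral_distr)

lemma ext_expectation_cong_AE:
  assumes "AE \<omega> in M. f \<omega> = g \<omega>"
  shows "ext_expectation M f = ext_expectation M g"
proof -
  have "(\<integral>\<^sup>+\<omega>. e2ennreal (f \<omega>) \<partial>M) = (\<integral>\<^sup>+\<omega>. e2ennreal (g \<omega>) \<partial>M)"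
    and "(\<integral>\<^sup>+\<omega>. e2ennreal (- f \<omega>) \<partial>M) = (\<integral>\<^sup>+\<omega>. e2ennreal (- g \<omega>) \<partial>M)"
    using assms by (auto intro!: nn_integral_cong_AE)
  then show ?thesis by (simp add: ext_expectation_def)
qed

lemma optimal_solutions_cong:
  assumes "\<And>x. x \<in> F \<Longrightarrow> f x = g x"
  shows "optimal_solutions f F = optimal_solutions g F"
  using assms by (auto simp: optimal_solutions_def is_arg_min_def)

text \<open>
  The two random vectors may live on different probability spaces: the expectation of a measurable
  function of either is an integral against their common law.
\<close>

lemma ext_expectation_eq_if_distr_eq:
  assumes "Z \<in> measurable M N" and "Z' \<in> measurable M' N" and "f \<in> borel_measurable N"
    and "distr M N Z = distr M' N Z'"
  shows "ext_expectation M (\<lambda>\<omega>. f (Z \<omega>)) = ext_expectation M' (\<lambda>\<omega>. f (Z' \<omega>))"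
  using assms by (metis ext_expectation_distr)

theorem lemma1:
  fixes X :: "(real^'n1) set" and Y :: "(real^'n2) set"
    and A :: "real^'n1^'m1" and b :: "real^'m1" and c :: "real^'n1"
    and P :: "real^'n1 \<Rightarrow> 'w measure"
    and \<xi> :: "'w \<Rightarrow> ('n1::finite, 'n2::finite, 'm2::finite) stage2_data"
    and M :: "'v measure"
    and \<xi>\<^sub>x :: "real^'n1 \<Rightarrow> 'v \<Rightarrow> ('n1, 'n2, 'm2) stage2_data"
    and \<theta> :: "'v \<Rightarrow> 'qt::euclidean_space \<times> 'ht::euclidean_space \<times>
                    'tt::euclidean_space \<times> 'wt::euclidean_space"
    and t1 :: "real^'n1 \<Rightarrow> 'qt \<Rightarrow> real^'n2"
    and t2 :: "real^'n1 \<Rightarrow> 'ht \<Rightarrow> real^'m2"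
    and t3 :: "real^'n1 \<Rightarrow> 'tt \<Rightarrow> real^'n1^'m2"
    and t4 :: "real^'n1 \<Rightarrow> 'wt \<Rightarrow> real^'n2^'m2"
  assumes "compact X" and "X \<subseteq> {x. 0 \<le> x}"
    and "compact Y" and "Y \<subseteq> {y. 0 \<le> y}"
    and "\<And>x. x \<in> X \<Longrightarrow> prob_space (P x)"
    and "\<And>x. x \<in> X \<Longrightarrow> \<xi> \<in> borel_measurable (P x)"
    and "prob_space M"
    and "\<And>x. x \<in> X \<Longrightarrow> \<xi>\<^sub>x x \<in> borel_measurable M"
    and "\<And>x. x \<in> X \<Longrightarrow> distr M borel (\<xi>\<^sub>x x) = distr (P x) borel \<xi>"
    and "\<theta> \<in> borel_measurable M"
    and "\<And>x. x \<in> X \<Longrightarrow> t1 x \<in> borel_measurable borel"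
    and "\<And>x. x \<in> X \<Longrightarrow> t2 x \<in> borel_measurable borel"
    and "\<And>x. x \<in> X \<Longrightarrow> t3 x \<in> borel_measurable borel"
    and "\<And>x. x \<in> X \<Longrightarrow> t4 x \<in> borel_measurable borel"
    and "\<And>x. x \<in> X \<Longrightarrow> AE \<omega> in M. \<xi>\<^sub>x x \<omega> = transformation t1 t2 t3 t4 x (\<theta> \<omega>)"
    and "\<And>x. x \<in> X \<Longrightarrow> second_stage_value Y x \<in>
           borel_measurable (borel :: ('n1, 'n2, 'm2) stage2_data measure)"
    and "\<And>x. x \<in> X \<Longrightarrow> transformed_value Y t1 t2 t3 t4 x \<in> borel_measurable borel"
    and "\<And>x. x \<in> X \<Longrightarrow>
           ext_expectation_defined (P x) (\<lambda>\<omega>. second_stage_value Y x (\<xi> \<omega>))"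
    and "\<And>x. x \<in> X \<Longrightarrow>
           ext_expectation_defined M (\<lambda>\<omega>. transformed_value Y t1 t2 t3 t4 x (\<theta> \<omega>))"
  shows "(\<forall>x\<in>{x \<in> X. A *v x \<ge> b}.
            ext_expectation (P x) (\<lambda>\<omega>. second_stage_value Y x (\<xi> \<omega>)) =
            ext_expectation M (\<lambda>\<omega>. transformed_value Y t1 t2 t3 t4 x (\<theta> \<omega>))) \<and>
         optimal_solutions
           (\<lambda>x. ereal (c \<bullet> x) + ext_expectation (P x) (\<lambda>\<omega>. second_stage_value Y x (\<xi> \<omega>)))
           {x \<in> X. A *v x \<ge> b} =
         optimal_solutions
           (\<lambda>x. ereal (c \<bullet> x) + ext_expectation M (\<lambda>\<omega>. transformed_value Y t1 t2 t3 t4 x (\<theta> \<omega>)))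
           {x \<in> X. A *v x \<ge> b}"
proof -
  have eq: "ext_expectation (P x) (\<lambda>\<omega>. second_stage_value Y x (\<xi> \<omega>)) =
      ext_expectation M (\<lambda>\<omega>. transformed_value Y t1 t2 t3 t4 x (\<theta> \<omega>))" if x: "x \<in> X" for x
  proof -
    have "ext_expectation (P x) (\<lambda>\<omega>. second_stage_value Y x (\<xi> \<omega>)) =
        ext_expectation M (\<lambda>\<omega>. second_stage_value Y x (\<xi>\<^sub>x x \<omega>))"
      using assms(6,8,9,16)[OF x] by (intro ext_expectation_eq_if_distr_eq[where N = borel]) auto
    also have "\<dots> = ext_expectation M (\<lambda>\<omega>. transformed_value Y t1 t2 t3 t4 x (\<theta> \<omega>))"
      using assms(15)[OF x]
      by (intro ext_expectation_cong_AE) (auto simp: transformed_value_eq_second_stage_value)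
    finally show ?thesis .
  qed
  show ?thesis
    by (intro conjI ballI optimal_solutions_cong) (simp_all add: eq)
qed

end
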